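(* For every real-valued function $f \in L^1(\mathbb{R})$, $$ \min_{0 \leq t \leq 1} \int_{\mathbb{R}} f(x) f(x+t)\, dx \leq 0.411\, \|f\|_{L^1}^2.$$ Moreover, the constant $0.411$ cannot be replaced by $0.37$; that is, there exists a real-valued $f \in L^1(\mathbb{R})$ such that $$ \min_{0 \leq t \leq 1} \int_{\mathbb{R}} f(x) f(x+t)\, dx > 0.37\, \|f\|_{L^1}^2.$$
   Context: All functions are real-valued and Lebesgue measurable on $\mathbb{R}$, and $\|f\|_{L^1} = \int_{\mathbb{R}} |f(x)|\,dx$. For $f \in L^1(\mathbb{R})$ the integral $\int_{\mathbb{R}} f(x)f(x+t)\,dx$ converges absolutely for almost every $t$. It is understood as an extended real number: it may equal $+\infty$ for some $t$ (for example at $t=0$ when $f \notin L^2(\mathbb{R})$), and a divergent integral is not assigned the value $0$. The expression $\min_{0 \le t \le 1}$ denotes the infimum over those $t \in [0,1]$ for which the integral is well defined as an element of $[-\infty,+\infty]$. *)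

theory Defs
  imports "HOL-Analysis.Analysis"
begin

text \<open>
  The Bochner integral assigns 0 to divergent integrals, so the integral of a real-valued function
  is taken here as an extended real number: integral of the positive part minus integral of the
  negative part (\<^const>\<open>ennreal\<close> truncates negative reals to 0). It is meaningful only
  if the two are not both infinite, since \<^typ>\<open>ereal\<close> gives \<open>\<infinity> - \<infinity>\<close> a junk value.
\<close>

definition ext_integral :: "'a measure \<Rightarrow> ('a \<Rightarrow> real) \<Rightarrow> ereal" where
  "ext_integral M g =
     enn2ereal (\<integral>\<^sup>+x. ennreal (g x) \<partial>M) - enn2ereal (\<integral>\<^sup>+x. ennreal (- g x) \<partial>M)"

definition ext_integral_defined :: "'a measure \<Rightarrow> ('a \<Rightarrow> real) \<Rightarrow> bool" where
  "ext_integral_defined M g \<longleftrightarrow>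
     g \<in> borel_measurable M \<and>
     \<not> ((\<integral>\<^sup>+x. ennreal (g x) \<partial>M) = \<infinity> \<and> (\<integral>\<^sup>+x. ennreal (- g x) \<partial>M) = \<infinity>)"

definition min_autocorrelation :: "(real \<Rightarrow> real) \<Rightarrow> ereal" where
  "min_autocorrelation f =
     (INF t \<in> {t \<in> {0..1}. ext_integral_defined lebesgue (\<lambda>x. f x * f (x + t))}.
        ext_integral lebesgue (\<lambda>x. f x * f (x + t)))"

definition L1_norm :: "(real \<Rightarrow> real) \<Rightarrow> real" where
  "L1_norm f = (LINT x|lebesgue. \<bar>f x\<bar>)"

end

theory Submission
  imports Defs
begin

text \<open>
  Write \<open>A t\<close> for the autocorrelation \<open>\<integral> f(x) f(x + t) dx\<close>. Passing to \<open>\<bar>f\<bar>\<close> only increases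
  \<open>A\<close>, so for the upper bound let \<open>f \<ge> 0\<close> with \<open>N = \<integral> f\<close>. Since \<open>A\<close> is even, \<open>A \<ge> m\<close> on \<open>[0,1]\<close> gives
  \<open>A \<ge> m\<close> on \<open>[-1,1]\<close>, and \<open>\<integral> A = N\<^sup>2\<close> already yields \<open>m \<le> N\<^sup>2 / 2\<close>. The gain comes from
  positive definiteness: the Fourier transform of \<open>A\<close> is the squared modulus of that of \<open>f\<close>, so
  \<open>\<integral> A(t) cos(w t) dt \<ge> 0\<close> for every frequency \<open>w\<close>. Subtracting this from \<open>\<integral> A\<close> gives
  \<open>\<integral> A(t) (1 - cos(w t)) dt \<le> N\<^sup>2\<close> (\<open>nn_weighted_autocorrelation_le\<close>). The weight is
  nonnegative, so the left side is at least its part over \<open>[-1,1]\<close>, which is at least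
  \<open>2 m (1 - sin w / w)\<close> (\<open>autocorrelation_lower_bound_le\<close>). The best \<open>w\<close> minimises \<open>sin w / w\<close>;
  it is close to \<open>4.4934\<close>, and \<open>w = 9/2\<close> gives \<open>m \<le> 0.4108 N\<^sup>2\<close>, just below \<open>0.411 N\<^sup>2\<close>.

  The example for the lower bound comes from the perfect ruler \<open>{0, 1, 4, 6}\<close>, whose four marks
  realise each of the distances \<open>1, \<dots>, 6\<close> exactly once. Let \<open>f\<close> be the indicator of the four intervals
  \<open>[b/6, (b+1)/6)\<close> with \<open>b\<close> a mark. At \<open>t = k/6\<close> with \<open>0 \<le> k \<le> 6\<close> some interval is moved exactly
  onto another one (or onto itself, if \<open>k = 0\<close>), so \<open>A(k/6) \<ge> 1/6\<close>. In between \<open>A\<close> is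
  linear (\<open>comb_autocorrelation_ge\<close> gives the inequality needed), hence
  \<open>A \<ge> 1/6\<close> on \<open>[0,1]\<close>, while \<open>N = 4/6\<close>. The ratio is \<open>(1/6) / (4/6)\<^sup>2 = 3/8 = 0.375\<close>.
\<close>

section \<open>The upper bound\<close>

text \<open>
  This is positive definiteness of the autocorrelation. Substituting \<open>y = x + t\<close>, the addition
  theorem turns the left side into \<open>N\<^sup>2 - C\<^sup>2 - S\<^sup>2\<close>, where \<open>N\<close> is the integral of \<open>g\<close>, and \<open>C\<close>
  and \<open>S\<close> are its cosine and sine transforms at \<open>w\<close>. Because \<open>1 - cos (w * t)\<close> is nonnegative,
  integrals in \<open>[0, \<infinity>]\<close> suffice, which also cover the \<open>t\<close> where the autocorrelation is infinite.
\<close>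

lemma nn_weighted_autocorrelation_le:
  fixes g :: "real \<Rightarrow> real"
  assumes g: "integrable lborel g" and nonneg: "\<And>x. 0 \<le> g x"
  shows "(\<integral>\<^sup>+t. ennreal (1 - cos (w * t)) * (\<integral>\<^sup>+x. ennreal (g x * g (x + t)) \<partial>lborel) \<partial>lborel)
           \<le> ennreal ((LINT x|lborel. g x)\<^sup>2)"
proof -
  have [measurable]: "g \<in> borel_measurable borel"
    using borel_measurable_integrable[OF g] by simp
  define N where "N = (LINT x|lborel. g x)"
  define C where "C = (LINT x|lborel. g x * cos (w * x))"
  define S where "S = (LINT x|lborel. g x * sin (w * x))"
  have gc: "integrable lborel (\<lambda>x. g x * cos (w * x))"
    by (rule Bochner_Integration.integrable_bound[OF g])
       (auto simp: abs_mult intro!: AE_I2 mult_left_le)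
  have gs: "integrable lborel (\<lambda>x. g x * sin (w * x))"
    by (rule Bochner_Integration.integrable_bound[OF g])
       (auto simp: abs_mult intro!: AE_I2 mult_left_le)
  define h where "h x y = g x * (g y - cos (w * x) * (g y * cos (w * y)) - sin (w * x) * (g y * sin (w * y)))" for x y
  \<comment> \<open>The form of \<open>h\<close> above is linear in the three integrable functions of \<open>y\<close>; the form below
    shows that \<open>h\<close> is nonnegative.\<close>
  have h_eq: "h x y = g x * g y * (1 - cos (w * (y - x)))" for x y
    by (simp add: h_def right_diff_distrib cos_diff algebra_simps)
  have h_nonneg: "0 \<le> h x y" for x y
    unfolding h_eq using nonneg by (intro mult_nonneg_nonneg) auto
  have h_int: "integrable lborel (h x)" for x
    unfolding h_def using g gc gs by auto
  have h_integral: "(LINT y|lborel. h x y) = N * g x - C * (g x * cos (w * x)) - S * (g x * sin (w * x))" for x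
  proof -
    have "(LINT y|lborel. h x y) = g x * (N - cos (w * x) * C - sin (w * x) * S)"
      unfolding h_def N_def C_def S_def using g gc gs by simp
    then show ?thesis by (simp add: algebra_simps)
  qed
  have "(\<integral>\<^sup>+t. ennreal (1 - cos (w * t)) * (\<integral>\<^sup>+x. ennreal (g x * g (x + t)) \<partial>lborel) \<partial>lborel)
      = (\<integral>\<^sup>+t. (\<integral>\<^sup>+x. ennreal (h x (x + t)) \<partial>lborel) \<partial>lborel)"
    by (intro nn_integral_cong, subst nn_integral_cmult[symmetric])
       (auto simp: h_eq ennreal_mult[symmetric] nonneg mult.commute)
  also have "\<dots> = (\<integral>\<^sup>+x. (\<integral>\<^sup>+t. ennreal (h x (x + t)) \<partial>lborel) \<partial>lborel)"
    unfolding h_def by (rule lborel_pair.Fubini') measurable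
  also have "\<dots> = (\<integral>\<^sup>+x. (\<integral>\<^sup>+y. ennreal (h x y) \<partial>lborel) \<partial>lborel)"
    using nn_integral_real_affine[of "\<lambda>y. ennreal (h x y)" 1 x for x]
    by (simp add: h_def)
  also have "\<dots> = (\<integral>\<^sup>+x. ennreal (LINT y|lborel. h x y) \<partial>lborel)"
    by (intro nn_integral_cong nn_integral_eq_integral h_int) (simp add: h_nonneg)
  also have "\<dots> = ennreal (LINT x|lborel. (LINT y|lborel. h x y))"
  proof (rule nn_integral_eq_integral)
    show "integrable lborel (\<lambda>x. LINT y|lborel. h x y)"
      unfolding h_integral using g gc gs by auto
  qed (simp add: h_nonneg)
  also have "(LINT x|lborel. (LINT y|lborel. h x y)) = N\<^sup>2 - C\<^sup>2 - S\<^sup>2"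
    unfolding h_integral using g gc gs
    by (simp add: N_def[symmetric] C_def[symmetric] S_def[symmetric] power2_eq_square)
  also have "ennreal (N\<^sup>2 - C\<^sup>2 - S\<^sup>2) \<le> ennreal (N\<^sup>2)"
    by (intro ennreal_leI) (smt (verit) zero_le_power2)
  finally show ?thesis by (simp add: N_def)
qed

lemma autocorrelation_lower_bound_le:
  fixes g :: "real \<Rightarrow> real"
  assumes g: "integrable lborel g" and nonneg: "\<And>x. 0 \<le> g x"
    and m: "0 \<le> m" "\<And>t. t \<in> {0..1} \<Longrightarrow> ennreal m \<le> (\<integral>\<^sup>+x. ennreal (g x * g (x + t)) \<partial>lborel)"
    and w: "0 < w"
  shows "m * (2 * (1 - sin w / w)) \<le> (LINT x|lborel. g x)\<^sup>2"
proof -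
  have [measurable]: "g \<in> borel_measurable borel"
    using borel_measurable_integrable[OF g] by simp
  define A where "A t = (\<integral>\<^sup>+x. ennreal (g x * g (x + t)) \<partial>lborel)" for t
  have A_even: "A (- t) = A t" for t
    unfolding A_def using nn_integral_real_affine[of "\<lambda>x. ennreal (g x * g (x - t))" 1 t]
    by (simp add: algebra_simps)
  have A_ge: "ennreal m \<le> A t" if "t \<in> {-1..1}" for t
    using m(2)[of t] m(2)[of "- t"] that A_even[of t]
    by (cases "0 \<le> t") (auto simp: A_def)
  have "ennreal (m * (2 * (1 - sin w / w))) =
      (\<integral>\<^sup>+t. ennreal (m * (1 - cos (w * t))) * indicator {-1..1} t \<partial>lborel)"
  proof -
    have "(\<integral>\<^sup>+t. ennreal (m * (1 - cos (w * t))) * indicator {-1..1} t \<partial>lborel)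
        = ennreal (m * (1 - sin (w * 1) / w) - m * (- 1 - sin (w * - 1) / w))"
    proof (rule nn_integral_FTC_Icc)
      fix t :: real
      show "((\<lambda>t. m * (t - sin (w * t) / w)) has_real_derivative m * (1 - cos (w * t))) (at t)"
        using w by (auto intro!: derivative_eq_intros)
      show "0 \<le> m * (1 - cos (w * t))" using m by (intro mult_nonneg_nonneg) auto
    qed auto
    then show ?thesis by (simp add: algebra_simps)
  qed
  also have "\<dots> \<le> (\<integral>\<^sup>+t. ennreal (1 - cos (w * t)) * A t \<partial>lborel)"
  proof (rule nn_integral_mono)
    fix t :: real
    show "ennreal (m * (1 - cos (w * t))) * indicator {-1..1} t \<le> ennreal (1 - cos (w * t)) * A t"
      using A_ge[of t] m(1)
      by (auto simp: ennreal_mult mult.commute[of m] indicator_def intro!: mult_left_mono)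
  qed
  also have "\<dots> \<le> ennreal ((LINT x|lborel. g x)\<^sup>2)"
    unfolding A_def by (rule nn_weighted_autocorrelation_le[OF g nonneg])
  finally show ?thesis by (simp add: ennreal_le_iff)
qed

text \<open>
  The numerical input. The bound \<open>m \<le> 0.411 N\<^sup>2\<close> requires \<open>2 * 0.411 * (1 - sin w / w) \<ge> 1\<close>, which at
  \<open>w = 9/2\<close> amounts to roughly \<open>sin w \<le> -0.97445\<close>, while the true value is \<open>-0.97753\<close>. To keep
  the Taylor polynomial short, it is evaluated at \<open>3/2\<close>, followed by the triple angle formula.
\<close>

lemma sin_nine_halves_le: "sin (9/2 :: real) \<le> - 0.9745"
proof -
  define s where "s = sin (3/2 :: real)"
  have "\<bar>s - (\<Sum>m<9. sin_coeff m * (3/2) ^ m)\<bar> \<le> inverse (fact 9) * \<bar>3/2\<bar> ^ 9"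
    unfolding s_def by (rule Maclaurin_sin_bound)
  then have "32 * \<bar>s * 71680 - 71493\<bar> \<le> 243"
    by (simp add: sin_coeff_def lessThan_nat_numeral fact_numeral field_simps)
  with abs_ge_minus_self[of "s * 71680 - 71493"] have s: "0.9972 \<le> s" by simp
  have "sin (9/2 :: real) = 3 * s - 4 * s ^ 3"
  proof -
    have "sin (9/2 :: real) = sin (2 * (3/2) + 3/2)" by simp
    also have "\<dots> = 2 * s * (cos (3/2))\<^sup>2 + (1 - 2 * s\<^sup>2) * s"
      unfolding sin_add sin_double cos_double_sin s_def by (simp add: power2_eq_square)
    also have "\<dots> = 3 * s - 4 * s ^ 3"
      unfolding s_def cos_squared_eq
      by (simp add: power2_eq_square power3_eq_cube algebra_simps)
    finally show ?thesis .
  qed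
  moreover have "3 * s - 4 * s ^ 3 = s * (3 - 4 * s\<^sup>2)"
    by (simp add: power2_eq_square power3_eq_cube algebra_simps)
  moreover have "s * (3 - 4 * s\<^sup>2) \<le> 0.9972 * (3 - 4 * 0.9972\<^sup>2)"
  proof -
    \<comment> \<open>For \<open>s \<ge> 0.9972\<close> the second factor is negative and decreasing in \<open>s\<close>.\<close>
    have "0.9972\<^sup>2 \<le> s\<^sup>2" using s by (intro power_mono) auto
    moreover have "s * (3 - 4 * s\<^sup>2) \<le> 0.9972 * (3 - 4 * s\<^sup>2)"
      using s calculation by (intro mult_right_mono_neg) (auto simp: power2_eq_square)
    ultimately show ?thesis by simp
  qed
  ultimately show ?thesis by (simp add: power2_eq_square)
qed

text \<open>
  If the autocorrelation of \<open>\<bar>f\<bar>\<close> at \<open>t\<close> is finite, then that of \<open>f\<close> is defined at \<open>t\<close> and cannot exceed it;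
  if it is infinite, the bound is trivial. So \<open>t\<close> may range over all of \<open>[0,1]\<close>, whether or not the
  infimum is taken over it.
\<close>

lemma min_autocorrelation_le_nn_autocorrelation:
  fixes f :: "real \<Rightarrow> real"
  assumes f: "f \<in> borel_measurable lebesgue" and t: "t \<in> {0..1}"
  shows "min_autocorrelation f \<le> enn2ereal (\<integral>\<^sup>+x. ennreal (\<bar>f x\<bar> * \<bar>f (x + t)\<bar>) \<partial>lebesgue)"
proof -
  define u where "u = (\<lambda>x. f x * f (x + t))"
  have "(\<lambda>x. t + x) \<in> lebesgue \<rightarrow>\<^sub>M lebesgue"
    using lebesgue_affine_measurable[of "\<lambda>_. 1" t] by simp
  from measurable_compose[OF this f] have "(\<lambda>x. f (x + t)) \<in> borel_measurable lebesgue"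
    by (simp add: add.commute)
  with f have u: "u \<in> borel_measurable lebesgue"
    unfolding u_def by (rule borel_measurable_times)
  define I where "I = (\<integral>\<^sup>+x. ennreal \<bar>u x\<bar> \<partial>lebesgue)"
  have pos: "(\<integral>\<^sup>+x. ennreal (u x) \<partial>lebesgue) \<le> I" and neg: "(\<integral>\<^sup>+x. ennreal (- u x) \<partial>lebesgue) \<le> I"
    unfolding I_def by (auto intro!: nn_integral_mono ennreal_leI)
  have "min_autocorrelation f \<le> enn2ereal I"
  proof (cases "I = \<infinity>")
    case False
    then have "ext_integral_defined lebesgue u"
      using u pos unfolding ext_integral_defined_def by (auto simp: top_unique)
    with t have "min_autocorrelation f \<le> ext_integral lebesgue u"
      unfolding min_autocorrelation_def u_def by (intro INF_lower) auto
    also have "\<dots> \<le> enn2ereal (\<integral>\<^sup>+x. ennreal (u x) \<partial>lebesgue) - 0"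
      unfolding ext_integral_def by (intro ereal_minus_mono) auto
    also have "\<dots> \<le> enn2ereal I" using pos by (simp add: less_eq_ennreal.rep_eq)
    finally show ?thesis .
  qed simp
  then show ?thesis by (simp add: I_def u_def abs_mult)
qed

text \<open>
  Tonelli's theorem, which the positive definiteness argument uses, requires product measurability
  of \<open>(x, t) \<mapsto> f(x + t)\<close>; this is immediate for Borel functions only. Hence \<open>\<bar>f\<bar>\<close> is replaced by a
  Borel function equal to it almost everywhere. The autocorrelation stays the same for every single
  \<open>t\<close>, because translates of null sets are null sets.
\<close>

lemma ex_borel_autocorrelation_eq:
  fixes f :: "real \<Rightarrow> real"
  assumes f: "integrable lebesgue f"
  obtains g where "integrable lborel g" "\<And>x. 0 \<le> g x" "(LINT x|lborel. g x) = L1_norm f"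
    "\<And>t. (\<integral>\<^sup>+x. ennreal (\<bar>f x\<bar> * \<bar>f (x + t)\<bar>) \<partial>lebesgue) = (\<integral>\<^sup>+x. ennreal (g x * g (x + t)) \<partial>lborel)"
proof -
  have fm: "f \<in> borel_measurable lebesgue" using f by auto
  then obtain g0 where g0: "g0 \<in> borel_measurable lborel" and ae0: "AE x in lborel. f x = g0 x"
    using completion_ex_borel_measurable_real[of f lborel] by auto
  define g where "g = (\<lambda>x. \<bar>g0 x\<bar>)"
  have gm [measurable]: "g \<in> borel_measurable borel" using g0 by (simp add: g_def)
  have ae: "AE x in lborel. \<bar>f x\<bar> = g x" using ae0 by eventually_elim (simp add: g_def)
  have gm': "g \<in> borel_measurable lebesgue" by (simp add: measurable_completion)
  have "integrable lebesgue g"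
    using integrable_cong_AE[of "\<lambda>x. \<bar>f x\<bar>" lebesgue g] fm gm' AE_completion[OF ae] f by auto
  then have int: "integrable lborel g"
    by (subst (asm) integrable_completion) auto
  have "L1_norm f = (LINT x|lebesgue. g x)"
    unfolding L1_norm_def using fm gm' AE_completion[OF ae] by (intro integral_cong_AE) auto
  then have norm: "(LINT x|lborel. g x) = L1_norm f" by (simp add: integral_completion)
  have eq: "(\<integral>\<^sup>+x. ennreal (\<bar>f x\<bar> * \<bar>f (x + t)\<bar>) \<partial>lebesgue) = (\<integral>\<^sup>+x. ennreal (g x * g (x + t)) \<partial>lborel)" for t
  proof -
    from ae obtain Z where Z: "{x. \<bar>f x\<bar> \<noteq> g x} \<subseteq> Z" "Z \<in> null_sets lborel"
      by (auto simp: eventually_ae_filter)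
    have [measurable]: "Z \<in> sets borel" using Z(2) by auto
    have "AE x in lborel. x \<notin> Z" using Z(2) by (rule AE_not_in)
    then have "AE x in lborel. t + 1 * x \<notin> Z" by (intro AE_borel_affine) auto
    then have "AE x in lborel. \<bar>f (x + t)\<bar> = g (x + t)"
      by eventually_elim (use Z(1) in \<open>auto simp: add.commute\<close>)
    with ae have "AE x in lborel. ennreal (\<bar>f x\<bar> * \<bar>f (x + t)\<bar>) = ennreal (g x * g (x + t))"
      by eventually_elim simp
    then show ?thesis unfolding nn_integral_completion by (rule nn_integral_cong_AE)
  qed
  from that[OF int _ norm eq] show ?thesis by (simp add: g_def)
qed

lemma min_autocorrelation_le:
  fixes f :: "real \<Rightarrow> real"
  assumes f: "integrable lebesgue f"
  shows "min_autocorrelation f \<le> ereal (0.411 * (L1_norm f)\<^sup>2)"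
proof (rule ccontr)
  assume "\<not> ?thesis"
  then obtain m where m: "0.411 * (L1_norm f)\<^sup>2 < m" "ereal m < min_autocorrelation f"
    using ereal_dense2 by (metis less_ereal.simps(1) not_le)
  obtain g where g: "integrable lborel g" "\<And>x. 0 \<le> g x" "(LINT x|lborel. g x) = L1_norm f"
    "\<And>t. (\<integral>\<^sup>+x. ennreal (\<bar>f x\<bar> * \<bar>f (x + t)\<bar>) \<partial>lebesgue) = (\<integral>\<^sup>+x. ennreal (g x * g (x + t)) \<partial>lborel)"
    by (rule ex_borel_autocorrelation_eq[OF f]) blast
  have m_nonneg: "0 \<le> m" by (rule order.trans[OF _ less_imp_le[OF m(1)]]) simp
  have "ennreal m \<le> (\<integral>\<^sup>+x. ennreal (g x * g (x + t)) \<partial>lborel)" if "t \<in> {0..1}" for t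
    using min_autocorrelation_le_nn_autocorrelation[OF borel_measurable_integrable[OF f] that] m(2) m_nonneg
    unfolding g(4) less_eq_ennreal.rep_eq by (simp add: enn2ereal_ennreal)
  from autocorrelation_lower_bound_le[OF g(1,2) m_nonneg this, of "9/2"]
  have "m * (2 * (1 - sin (9/2) / (9/2))) \<le> (L1_norm f)\<^sup>2"
    by (simp add: g(3))
  moreover have "m * (1 / 0.411) \<le> m * (2 * (1 - sin (9/2) / (9/2)))"
    using sin_nine_halves_le m_nonneg by (intro mult_left_mono) auto
  ultimately show False using m(1) by (simp add: field_simps)
qed

section \<open>The lower bound\<close>

text \<open>
  The indicator of the union of the cells \<open>[b/n, (b+1)/n)\<close> with \<open>b \<in> B\<close>. With the floor function, the
  cell of a point determines the value, and cells are disjoint without further argument.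
\<close>

definition comb :: "int set \<Rightarrow> real \<Rightarrow> real \<Rightarrow> real" where
  "comb B n x = indicator B \<lfloor>n * x\<rfloor>"

lemma comb_measurable [measurable]: "comb B n \<in> borel_measurable borel"
proof -
  have "(\<lambda>x::real. \<lfloor>n * x\<rfloor>) \<in> borel \<rightarrow>\<^sub>M count_space UNIV" by measurable
  then show ?thesis unfolding comb_def by measurable
qed

lemma nn_integral_comb:
  assumes n: "0 < n" and B: "finite B"
  shows "(\<integral>\<^sup>+x. ennreal (comb B n x) \<partial>lborel) = ennreal (real (card B) / n)"
proof -
  have "ennreal (comb B n x) = (\<Sum>b\<in>B. indicator {b / n..<(b + 1) / n} x)" for x
  proof -
    have "b = \<lfloor>n * x\<rfloor> \<longleftrightarrow> x \<in> {b / n..<(b + 1) / n}" for b :: int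
      using n by (auto simp: floor_eq_iff field_simps eq_commute[of b])
    then have "indicator {b / n..<(b + 1) / n} x = (if b = \<lfloor>n * x\<rfloor> then 1 else 0 :: ennreal)" for b :: int
      by (simp add: indicator_def)
    then show ?thesis using B by (simp add: comb_def indicator_def)
  qed
  then have "(\<integral>\<^sup>+x. ennreal (comb B n x) \<partial>lborel) = (\<Sum>b\<in>B. ennreal (1 / n))"
    using n by (simp add: nn_integral_sum field_simps)
  also have "\<dots> = ennreal (real (card B) / n)"
    using n by (simp add: ennreal_of_nat_eq_real_of_nat ennreal_mult[symmetric])
  finally show ?thesis .
qed

text \<open>
  Let \<open>n * t = k + v\<close> with \<open>0 \<le> v \<le> 1\<close>. The shift by \<open>t\<close> moves the first \<open>1 - v\<close> part of the cell \<open>a\<close>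
  into the cell \<open>a + k\<close>, and the last \<open>v\<close> part of the cell \<open>b\<close> into the cell \<open>b + k + 1\<close>. These
  two pieces \<open>P\<close> and \<open>Q\<close> are disjoint even if \<open>a = b\<close>, and their lengths add up to one full cell.
  Thus two consecutive differences of \<open>B\<close> control all shifts between them.
\<close>

lemma comb_autocorrelation_ge:
  assumes n: "0 < n" and k: "of_int k \<le> n * t" "n * t \<le> of_int k + 1"
    and "a \<in> B" "a + k \<in> B" "b \<in> B" "b + k + 1 \<in> B"
  shows "ennreal (1 / n) \<le> (\<integral>\<^sup>+x. ennreal (comb B n x * comb B n (x + t)) \<partial>lborel)"
proof -
  define v where "v = n * t - of_int k"
  have v: "0 \<le> v" "v \<le> 1" using k by (auto simp: v_def)
  define P where "P = {a / n..<(a + (1 - v)) / n}"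
  define Q where "Q = {(b + (1 - v)) / n..<(b + 1) / n}"
  have P: "\<lfloor>n * x\<rfloor> = a \<and> \<lfloor>n * (x + t)\<rfloor> = a + k" if "x \<in> P" for x
    using that n v by (auto simp: P_def floor_eq_iff v_def field_simps)
  have Q: "\<lfloor>n * x\<rfloor> = b \<and> \<lfloor>n * (x + t)\<rfloor> = b + k + 1" if "x \<in> Q" for x
    using that n v by (auto simp: Q_def floor_eq_iff v_def field_simps)
  have disj: "x \<notin> P \<or> x \<notin> Q" for x
    using P[of x] Q[of x] by auto
  have "ennreal (1 / n) = ennreal ((1 - v) / n) + ennreal (v / n)"
    using v n by (simp flip: ennreal_plus add: add_divide_distrib[symmetric])
  also have "\<dots> = (\<integral>\<^sup>+x. indicator P x \<partial>lborel) + (\<integral>\<^sup>+x. indicator Q x \<partial>lborel)"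
    using v n by (simp add: P_def Q_def divide_right_mono diff_divide_distrib[symmetric])
  also have "\<dots> = (\<integral>\<^sup>+x. indicator P x + indicator Q x \<partial>lborel)"
    by (subst nn_integral_add) (auto simp: P_def Q_def)
  also have "\<dots> \<le> (\<integral>\<^sup>+x. ennreal (comb B n x * comb B n (x + t)) \<partial>lborel)"
  proof (rule nn_integral_mono)
    fix x
    show "indicator P x + indicator Q x \<le> ennreal (comb B n x * comb B n (x + t))"
      using P[of x] Q[of x] disj[of x] assms(4-)
      by (auto simp: indicator_def comb_def)
  qed
  finally show ?thesis .
qed

lemma ruler_autocorrelation_ge:
  fixes t :: real
  assumes t: "t \<in> {0..1}"
  shows "ennreal (1 / 6) \<le> (\<integral>\<^sup>+x. ennreal (comb {0, 1, 4, 6} 6 x * comb {0, 1, 4, 6} 6 (x + t)) \<partial>lborel)"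
proof -
  have witness: "\<exists>a b. a \<in> {0, 1, 4, 6} \<and> a + k \<in> {0, 1, 4, 6} \<and> b \<in> {0, 1, 4, 6} \<and> b + k + 1 \<in> {0, 1, 4, 6}"
    if "k \<in> {0, 1, 2, 3, 4, 5}" for k :: int
    using that by (elim insertE emptyE; simp; presburger)
  obtain k :: int where k: "k \<in> {0, 1, 2, 3, 4, 5}" "of_int k \<le> 6 * t" "6 * t \<le> of_int k + 1"
  proof
    \<comment> \<open>The minimum matters at \<open>t = 1\<close> only: \<open>k = 6\<close> would require the difference \<open>7\<close>.\<close>
    define k where "k = min 5 \<lfloor>6 * t\<rfloor>"
    have "0 \<le> k" "k \<le> 5" using t by (auto simp: k_def)
    then show "k \<in> {0, 1, 2, 3, 4, 5}" by auto
    show "of_int k \<le> 6 * t" by (simp add: k_def le_floor_iff[symmetric])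
    show "6 * t \<le> of_int k + 1" using t by (auto simp: k_def min_def)
  qed
  from witness[OF k(1)] comb_autocorrelation_ge[OF _ k(2,3)] show ?thesis by force
qed

lemma ex_min_autocorrelation_gt:
  "\<exists>f :: real \<Rightarrow> real. integrable lebesgue f \<and> ereal (0.37 * (L1_norm f)\<^sup>2) < min_autocorrelation f"
proof (intro exI conjI)
  define f where "f = comb {0, 1, 4, 6} 6"
  have [measurable]: "f \<in> borel_measurable borel" by (simp add: f_def)
  have nonneg: "0 \<le> f x" for x by (simp add: f_def comb_def)
  have hbi: "has_bochner_integral lborel f (4 / 6)"
    using nn_integral_comb[of 6 "{0, 1, 4, 6}"] nonneg
    by (intro has_bochner_integral_nn_integral) (auto simp: f_def)
  then show "integrable lebesgue f"
    by (subst integrable_completion) (auto simp: has_bochner_integral_iff)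
  have "L1_norm f = 4 / 6"
    using hbi by (simp add: L1_norm_def nonneg integral_completion has_bochner_integral_iff)
  then have "ereal (0.37 * (L1_norm f)\<^sup>2) < ereal (1 / 6)" by (simp only: less_ereal.simps) (simp add: power2_eq_square)
  also have "ereal (1 / 6) \<le> min_autocorrelation f"
    unfolding min_autocorrelation_def
  proof (rule INF_greatest)
    fix t assume "t \<in> {t \<in> {0..1}. ext_integral_defined lebesgue (\<lambda>x. f x * f (x + t))}"
    then have "ennreal (1 / 6) \<le> (\<integral>\<^sup>+x. ennreal (f x * f (x + t)) \<partial>lborel)"
      unfolding f_def by (intro ruler_autocorrelation_ge) auto
    then show "ereal (1 / 6) \<le> ext_integral lebesgue (\<lambda>x. f x * f (x + t))"
      by (simp add: ext_integral_def nn_integral_completion ennreal_neg nonneg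
          less_eq_ennreal.rep_eq enn2ereal_ennreal zero_ennreal.rep_eq)
  qed
  finally show "ereal (0.37 * (L1_norm f)\<^sup>2) < min_autocorrelation f" .
qed

theorem theorem2:
  shows "(\<forall>f :: real \<Rightarrow> real. integrable lebesgue f \<longrightarrow>
            min_autocorrelation f \<le> ereal (0.411 * (L1_norm f)\<^sup>2)) \<and>
         (\<exists>f :: real \<Rightarrow> real. integrable lebesgue f \<and>
            min_autocorrelation f > ereal (0.37 * (L1_norm f)\<^sup>2))"
  using min_autocorrelation_le ex_min_autocorrelation_gt by blast

end
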